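(* Let $X$ be a Banach space and let $S=(X;X_k,k\geqslant 1)$ be a system of closed linear subspaces of $X$ which is a permutational representing system of subspaces in $X$. Define $X_k'=\bigcap_{j\neq k}X_j^{\bot}\subset X^*$, $k\geqslant 1$. Then the system of subspaces $X_k'$, $k\geqslant 1$, is an unconditional Schauder decomposition of the closure (in $X^*$) of its linear span.
   Context: $X$ is a Banach space over $\mathbb{K}$ ($=\mathbb{R}$ or $\mathbb{C}$), $X^*$ is its dual. "Subspace" means closed linear subset. A system $S=(X;X_k,k\geqslant 1)$ of subspaces of $X$ is a representing system of subspaces in $X$ if every $x\in X$ can be written as a norm-convergent series $x=\sum_{k=1}^\infty x_k$ with $x_k\in X_k$, $k\geqslant 1$. The system $S$ is a permutational representing system of subspaces in $X$ if for every bijection $\sigma:\mathbb{N}\to\mathbb{N}$ the system $S_\sigma=(X;X_{\sigma(k)},k\geqslant 1)$ is a representing system of subspaces in $X$. For $M\subset X$, $M^{\bot}=\{\varphi\in X^*: \varphi(x)=0 \text{ for all } x\in M\}$. A system of subspaces $G_k$, $k\geqslant 1$, of a Banach space $E$ is called a Schauder decomposition of $E$ if for every $x\in E$ there exist unique $x_k\in G_k$, $k\geqslant 1$, such that $x=\sum_{k=1}^\infty x_k$ (norm convergence); the $G_k$ are allowed to be zero. A Schauder decomposition is called unconditional if every convergent series of the form $\sum_{k=1}^\infty x_k$, $x_k\in G_k$, converges unconditionally. *)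

theory Defs
  imports "HOL-Analysis.Analysis"
begin

text \<open>
  A Banach space over \<open>\<K> = \<real>\<close> or \<open>\<K> = \<complex>\<close> is a real Banach space (type class \<^class>\<open>banach\<close>)
  together with a multiplication by scalars from \<open>\<K>\<close> that extends the real one and for which
  the given norm is homogeneous.  The scalar field is a type \<open>'k :: {real_normed_field, banach}\<close>;
  \<^typ>\<open>real\<close> and \<^typ>\<open>complex\<close> are instances, and by the Gelfand--Mazur theorem every other
  instance is isometrically isomorphic to one of them.
\<close>

locale banach_space_over = vector_space scl
  for scl :: "'k::{real_normed_field,banach} \<Rightarrow> 'a::banach \<Rightarrow> 'a" +
  assumes scale_of_real: "scl (of_real r) x = r *\<^sub>R x"
    and norm_scale: "norm (scl c x) = norm c * norm x"

lemma banach_space_over_real: "banach_space_over (scaleR :: real \<Rightarrow> 'a::banach \<Rightarrow> 'a)"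
  by unfold_locales (auto simp: algebra_simps)

lemma banach_space_over_complex: "banach_space_over ((*) :: complex \<Rightarrow> complex \<Rightarrow> complex)"
  by unfold_locales (auto simp: algebra_simps norm_mult scaleR_conv_of_real)

definition closed_subspace :: "('k::{real_normed_field,banach} \<Rightarrow> 'a::banach \<Rightarrow> 'a) \<Rightarrow> 'a set \<Rightarrow> bool"
  where "closed_subspace scl M \<longleftrightarrow> module.subspace scl M \<and> closed M"

text \<open>Sequences of subspaces are indexed from \<open>0\<close> instead of \<open>1\<close>.\<close>

definition representing_system ::
    "('k::{real_normed_field,banach} \<Rightarrow> 'a::banach \<Rightarrow> 'a) \<Rightarrow> (nat \<Rightarrow> 'a set) \<Rightarrow> bool"
  where "representing_system scl X \<longleftrightarrow>
    (\<forall>k. closed_subspace scl (X k)) \<and>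
    (\<forall>x. \<exists>xs. (\<forall>k. xs k \<in> X k) \<and> xs sums x)"

definition permutational_representing_system ::
    "('k::{real_normed_field,banach} \<Rightarrow> 'a::banach \<Rightarrow> 'a) \<Rightarrow> (nat \<Rightarrow> 'a set) \<Rightarrow> bool"
  where "permutational_representing_system scl X \<longleftrightarrow>
    (\<forall>\<sigma>::nat \<Rightarrow> nat. bij \<sigma> \<longrightarrow> representing_system scl (\<lambda>k. X (\<sigma> k)))"

text \<open>
  The dual space consists of the \<open>\<K>\<close>-linear elements of \<open>'a \<Rightarrow>\<^sub>L 'k\<close>, whose elements are only
  real-linear a priori.  The norm of \<open>'a \<Rightarrow>\<^sub>L 'k\<close> is the operator norm, hence on the dual space
  it is the dual norm.
\<close>

definition dual :: "('k::{real_normed_field,banach} \<Rightarrow> 'a::banach \<Rightarrow> 'a) \<Rightarrow> ('a \<Rightarrow>\<^sub>L 'k) set"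
  where "dual scl = {\<phi>. \<forall>c x. blinfun_apply \<phi> (scl c x) = c * blinfun_apply \<phi> x}"

definition dual_scale :: "'k::{real_normed_field,banach} \<Rightarrow> ('a::banach \<Rightarrow>\<^sub>L 'k) \<Rightarrow> ('a \<Rightarrow>\<^sub>L 'k)"
  where "dual_scale c \<phi> = blinfun_mult_right c o\<^sub>L \<phi>"

lemma dual_scale_apply [simp]: "blinfun_apply (dual_scale c \<phi>) x = c * blinfun_apply \<phi> x"
  by (simp add: dual_scale_def)

lemma banach_space_over_dual:
  "banach_space_over (dual_scale :: 'k \<Rightarrow> ('a::banach \<Rightarrow>\<^sub>L 'k::{real_normed_field,banach}) \<Rightarrow> _)"
proof unfold_locales
  fix c :: 'k and \<phi> :: "'a \<Rightarrow>\<^sub>L 'k"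
  have "norm (dual_scale c \<phi>) \<le> norm c * norm \<phi>" for c and \<phi> :: "'a \<Rightarrow>\<^sub>L 'k"
  proof (rule norm_blinfun_bound)
    fix x
    have "norm c * norm (blinfun_apply \<phi> x) \<le> norm c * (norm \<phi> * norm x)"
      by (intro mult_left_mono norm_blinfun) simp
    then show "norm (blinfun_apply (dual_scale c \<phi>) x) \<le> norm c * norm \<phi> * norm x"
      by (simp add: norm_mult mult.assoc)
  qed simp
  note le = this
  show "norm (dual_scale c \<phi>) = norm c * norm \<phi>"
  proof (cases "c = 0")
    case True
    then show ?thesis using le[of c \<phi>] by simp
  next
    case False
    then have "dual_scale (inverse c) (dual_scale c \<phi>) = \<phi>"
      by (intro blinfun_eqI) simp
    then have "norm \<phi> \<le> norm (inverse c) * norm (dual_scale c \<phi>)"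
      using le[of "inverse c" "dual_scale c \<phi>"] by simp
    then have "norm c * norm \<phi> \<le> norm (dual_scale c \<phi>)"
      using False by (simp add: norm_divide field_simps)
    with le[of c \<phi>] show ?thesis by simp
  qed
qed (auto intro!: blinfun_eqI simp: blinfun.bilinear_simps algebra_simps scaleR_conv_of_real)

lemma closed_subspace_dual: "closed_subspace dual_scale (dual scl)"
proof -
  interpret D: banach_space_over "dual_scale :: _ \<Rightarrow> ('b::banach \<Rightarrow>\<^sub>L 'a) \<Rightarrow> _"
    by (rule banach_space_over_dual)
  have "dual scl = (\<Inter>c x. {\<phi>. blinfun_apply \<phi> (scl c x) = c * blinfun_apply \<phi> x})"
    by (auto simp: dual_def)
  also have "closed \<dots>"
    by (intro closed_INT ballI closed_Collect_eq continuous_intros)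
  finally show ?thesis
    by (auto simp: closed_subspace_def D.subspace_def dual_def blinfun.bilinear_simps algebra_simps)
qed

definition annihilator ::
    "('k::{real_normed_field,banach} \<Rightarrow> 'a::banach \<Rightarrow> 'a) \<Rightarrow> 'a set \<Rightarrow> ('a \<Rightarrow>\<^sub>L 'k) set"
  where "annihilator scl M = {\<phi> \<in> dual scl. \<forall>x\<in>M. blinfun_apply \<phi> x = 0}"

definition dual_system ::
    "('k::{real_normed_field,banach} \<Rightarrow> 'a::banach \<Rightarrow> 'a) \<Rightarrow> (nat \<Rightarrow> 'a set) \<Rightarrow> nat \<Rightarrow> ('a \<Rightarrow>\<^sub>L 'k) set"
  where "dual_system scl X k = (\<Inter>j\<in>{j. j \<noteq> k}. annihilator scl (X j))"

text \<open>The Banach space \<open>E\<close> is given as a closed subspace of an ambient Banach space.\<close>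

definition schauder_decomposition ::
    "('k::{real_normed_field,banach} \<Rightarrow> 'a::banach \<Rightarrow> 'a) \<Rightarrow> 'a set \<Rightarrow> (nat \<Rightarrow> 'a set) \<Rightarrow> bool"
  where "schauder_decomposition scl E G \<longleftrightarrow>
    closed_subspace scl E \<and>
    (\<forall>k. closed_subspace scl (G k) \<and> G k \<subseteq> E) \<and>
    (\<forall>x\<in>E. \<exists>!xs. (\<forall>k. xs k \<in> G k) \<and> xs sums x)"

definition unconditionally_convergent :: "(nat \<Rightarrow> 'a::real_normed_vector) \<Rightarrow> bool"
  where "unconditionally_convergent xs \<longleftrightarrow> (\<forall>\<sigma>::nat \<Rightarrow> nat. bij \<sigma> \<longrightarrow> summable (\<lambda>k. xs (\<sigma> k)))"

definition unconditional_schauder_decomposition ::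
    "('k::{real_normed_field,banach} \<Rightarrow> 'a::banach \<Rightarrow> 'a) \<Rightarrow> 'a set \<Rightarrow> (nat \<Rightarrow> 'a set) \<Rightarrow> bool"
  where "unconditional_schauder_decomposition scl E G \<longleftrightarrow>
    schauder_decomposition scl E G \<and>
    (\<forall>xs. (\<forall>k. xs k \<in> G k) \<and> summable xs \<longrightarrow> unconditionally_convergent xs)"

end

theory Submission
  imports Defs
begin

text \<open>
  The point of the proof is that every rearrangement can be treated separately: it suffices that
  for each single representing system \<open>X\<close> the sums of convergent series \<open>\<Sum>k. \<phi>\<^sub>k\<close> with
  \<open>\<phi>\<^sub>k \<in> X\<^sub>k'\<close> form the closed linear span of the \<open>X\<^sub>k'\<close>
  (\<open>closure_span_dual_system_eq\<close>), because this span does not depend on the order of the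
  subspaces.

  An element of \<open>X\<^sub>k'\<close> vanishes on every other \<open>X\<^sub>j\<close>, so it is determined by its
  restriction to \<open>X\<^sub>k\<close> (\<open>dual_system_eqI\<close>), and the \<open>k\<close>-th term of a series with sum \<open>\<phi>\<close>
  coincides with \<open>\<phi>\<close> on \<open>X\<^sub>k\<close> (\<open>dual_system_sums_apply\<close>).  Hence the terms are
  determined by the sum, whatever the order of summation.

  For the closedness of the set of sums, let \<open>\<phi>\<close> be the sum of \<open>\<phi>\<^sub>k\<close> for \<open>k < N\<close>, and
  let \<open>x = \<Sum>k. x\<^sub>k\<close> with \<open>x\<^sub>k \<in> X\<^sub>k\<close>.  For \<open>n \<le> N\<close> the \<open>n\<close>-th partial
  sum of the \<open>\<phi>\<^sub>k\<close> maps \<open>x\<close> to the value of \<open>\<phi>\<close> at the \<open>n\<close>-th partial sum of the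
  \<open>x\<^sub>k\<close> (\<open>dual_system_partial_sum_apply\<close>).  The latter partial sums are bounded, so the
  partial sums on the dual side, for \<open>\<phi>\<close> in the unit ball, are pointwise bounded, and by
  the uniform boundedness principle they are bounded in norm
  (\<open>dual_system_partial_sum_bound\<close>).  Sequences of closed subspaces with uniformly bounded
  partial sums have a closed set of sums (\<open>closed_sums_of_subspaces\<close>).

  Finally, let \<open>\<phi> = \<Sum>k. \<phi>\<^sub>k\<close> and let \<open>\<sigma>\<close> be a permutation.  The system permuted by
  \<open>\<sigma>\<close> is representing as well, so \<open>\<phi>\<close> also has an expansion in that order.  Its terms are
  \<open>\<phi>\<^bsub>\<sigma>(k)\<^esub>\<close>, so the rearranged series converges.
\<close>

section \<open>The uniform boundedness principle\<close>

text \<open>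
  The sets \<open>A n\<close> of points at which the family is bounded by \<open>n\<close> are closed and cover the
  space, so by Baire's theorem one of them contains a ball.
\<close>

lemma uniform_boundedness:
  fixes F :: "('a::banach \<Rightarrow>\<^sub>L 'b::real_normed_vector) set"
  assumes pointwise: "\<And>x. bounded ((\<lambda>\<phi>. blinfun_apply \<phi> x) ` F)"
  shows "bounded F"
proof -
  define A where "A n = {x. \<forall>\<phi>\<in>F. norm (blinfun_apply \<phi> x) \<le> real n}" for n
  have closed_A: "closed (A n)" for n
  proof -
    have "A n = (\<Inter>\<phi>\<in>F. {x. norm (blinfun_apply \<phi> x) \<le> real n})"
      by (auto simp: A_def)
    then show ?thesis
      by (auto intro!: closed_Collect_le continuous_intros)
  qed
  have UN_A: "(\<Union>n. A n) = UNIV"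
  proof (intro equalityI subsetI UNIV_I)
    fix x
    obtain B where "\<forall>\<phi>\<in>F. norm (blinfun_apply \<phi> x) \<le> B"
      using pointwise[of x] by (auto simp: bounded_iff)
    moreover obtain n where "B \<le> real n"
      using real_arch_simple by blast
    ultimately have "x \<in> A n"
      by (force simp: A_def)
    then show "x \<in> (\<Union>n. A n)" by blast
  qed
  have "\<exists>n. interior (A n) \<noteq> {}"
  proof (rule ccontr)
    assume "\<nexists>n. interior (A n) \<noteq> {}"
    then have "Met_TC.mtopology interior_of (\<Union>n. A n) = {}"
      using closed_A Met_TC.metric_Baire_category_alt[of "range A"]
      by (force simp: complete_UNIV)
    then show False
      by (simp add: UN_A)
  qed
  then obtain n x0 where "x0 \<in> interior (A n)" by blast
  then obtain r where r: "r > 0" "cball x0 r \<subseteq> A n"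
    by (meson mem_interior_cball)
  have "norm \<phi> \<le> 2 * real n / r" if "\<phi> \<in> F" for \<phi>
  proof (rule norm_blinfun_bound)
    fix x
    show "norm (blinfun_apply \<phi> x) \<le> 2 * real n / r * norm x"
    proof (cases "x = 0")
      case False
      define y where "y = (r / norm x) *\<^sub>R x"
      have "x0 + y \<in> A n" "x0 \<in> A n"
        using r False by (auto simp: y_def dist_norm subset_iff)
      then have "norm (blinfun_apply \<phi> (x0 + y)) \<le> real n" "norm (blinfun_apply \<phi> x0) \<le> real n"
        using that by (auto simp: A_def)
      moreover have "norm (blinfun_apply \<phi> y) = norm (blinfun_apply \<phi> (x0 + y) - blinfun_apply \<phi> x0)"
        by (simp add: blinfun.bilinear_simps)
      ultimately have "norm (blinfun_apply \<phi> y) \<le> 2 * real n"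
        using norm_triangle_ineq4[of "blinfun_apply \<phi> (x0 + y)" "blinfun_apply \<phi> x0"] by linarith
      then show ?thesis
        using r False by (simp add: y_def blinfun.bilinear_simps field_simps)
    qed simp
  qed (use r in simp)
  then show ?thesis
    by (auto simp: bounded_iff)
qed

section \<open>Series with uniformly bounded partial sums\<close>

lemma norm_partial_sum_le_norm_sum:
  fixes f :: "nat \<Rightarrow> 'a::real_normed_vector"
  assumes bound: "\<And>n N. n \<le> N \<Longrightarrow> norm (sum f {..<n}) \<le> C * norm (sum f {..<N})"
    and "f sums x"
  shows "norm (sum f {..<n}) \<le> C * norm x"
proof (rule LIMSEQ_le_const)
  show "(\<lambda>N. C * norm (sum f {..<N})) \<longlonglongrightarrow> C * norm x"
    using assms(2) by (auto simp: sums_def intro!: tendsto_intros)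
qed (use bound in auto)

text \<open>
  By the bound, the partial sums of the expansions of \<open>x\<^sub>m\<close> are Cauchy in \<open>m\<close>, uniformly
  in the number of terms.  Their limits are therefore the partial sums of an expansion of
  \<open>lim x\<^sub>m\<close>.
\<close>

lemma closed_sums_of_subspaces:
  fixes G :: "nat \<Rightarrow> 'a::banach set"
  assumes closed: "\<And>k. closed (G k)"
    and diff: "\<And>k x y. x \<in> G k \<Longrightarrow> y \<in> G k \<Longrightarrow> x - y \<in> G k"
    and bound: "\<And>f n N. (\<And>k. f k \<in> G k) \<Longrightarrow> n \<le> N \<Longrightarrow>
      norm (sum f {..<n}) \<le> C * norm (sum f {..<N})"
  shows "closed {x. \<exists>f. (\<forall>k. f k \<in> G k) \<and> f sums x}"
  unfolding closed_sequential_limits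
proof (intro allI impI, elim conjE)
  fix x :: "nat \<Rightarrow> 'a" and l
  assume "\<forall>m. x m \<in> {x. \<exists>f. (\<forall>k. f k \<in> G k) \<and> f sums x}" and lim: "x \<longlonglongrightarrow> l"
  then have "\<forall>m. \<exists>f. (\<forall>k. f k \<in> G k) \<and> f sums x m" by simp
  then obtain f where fG: "\<And>m k. f m k \<in> G k" and f: "\<And>m. f m sums x m"
    by metis
  have diff_bound: "norm (sum (f m) {..<n} - sum (f p) {..<n}) \<le> C * norm (x m - x p)" for m p n
    using norm_partial_sum_le_norm_sum[of "\<lambda>k. f m k - f p k" C "x m - x p" n]
      bound[of "\<lambda>k. f m k - f p k"] sums_diff[OF f f, of m p] diff fG
    by (simp add: sum_subtractf)
  \<comment> \<open>Nothing forces \<open>C\<close> to be positive, and the estimates below divide by the constant.\<close>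
  define D where "D = max C 1"
  have D: "D > 0" "C \<le> D" by (auto simp: D_def)
  have "convergent (\<lambda>m. sum (f m) {..<n})" for n
  proof (rule Cauchy_convergent, rule CauchyI)
    fix e :: real assume "e > 0"
    then have "e / D > 0" using D by simp
    then obtain M where M: "\<And>m p. m \<ge> M \<Longrightarrow> p \<ge> M \<Longrightarrow> norm (x m - x p) < e / D"
      using CauchyD[OF LIMSEQ_imp_Cauchy[OF lim]] by blast
    have "norm (sum (f m) {..<n} - sum (f p) {..<n}) < e" if "m \<ge> M" "p \<ge> M" for m p
    proof -
      have "C * norm (x m - x p) \<le> D * norm (x m - x p)"
        using D by (intro mult_right_mono) auto
      also have "\<dots> < e" using M[OF that] D by (simp add: field_simps)
      finally show ?thesis using diff_bound[of m n p] by linarith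
    qed
    then show "\<exists>M. \<forall>m\<ge>M. \<forall>p\<ge>M. norm (sum (f m) {..<n} - sum (f p) {..<n}) < e"
      by blast
  qed
  then obtain s where s: "\<And>n. (\<lambda>m. sum (f m) {..<n}) \<longlonglongrightarrow> s n"
    unfolding convergent_def by metis
  define g where "g k = s (Suc k) - s k" for k
  have f_lim: "(\<lambda>m. f m k) \<longlonglongrightarrow> g k" for k
    using tendsto_diff[OF s s, of "Suc k" k] by (simp add: g_def)
  have gG: "g k \<in> G k" for k
    by (rule closed_sequentially[OF closed fG f_lim])
  have "s 0 = 0"
    using s[of 0] by (simp add: LIMSEQ_const_iff)
  then have sum_g: "sum g {..<n} = s n" for n
    by (induction n) (auto simp: g_def)
  have near: "norm (s n - sum (f m) {..<n}) \<le> D * norm (l - x m)" for m n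
  proof -
    have "norm (s n - sum (f m) {..<n}) \<le> C * norm (l - x m)"
    proof (rule LIMSEQ_le)
      show "(\<lambda>p. norm (sum (f p) {..<n} - sum (f m) {..<n})) \<longlonglongrightarrow> norm (s n - sum (f m) {..<n})"
        by (intro tendsto_intros s)
      show "(\<lambda>p. C * norm (x p - x m)) \<longlonglongrightarrow> C * norm (l - x m)"
        by (intro tendsto_intros lim)
    qed (use diff_bound in blast)
    also have "\<dots> \<le> D * norm (l - x m)"
      using D by (intro mult_right_mono) auto
    finally show ?thesis .
  qed
  have "s \<longlonglongrightarrow> l"
  proof (rule LIMSEQ_I)
    fix e :: real assume e: "e > 0"
    then have "e / (2 * (D + 1)) > 0" using D by simp
    then obtain m where m: "norm (x m - l) < e / (2 * (D + 1))"
      using LIMSEQ_D[OF lim] by blast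
    then have small: "(D + 1) * norm (l - x m) < e / 2"
      using D by (simp add: field_simps norm_minus_commute)
    obtain N where N: "\<And>n. n \<ge> N \<Longrightarrow> norm (sum (f m) {..<n} - x m) < e / 2"
      using LIMSEQ_D[OF f[of m, unfolded sums_def], of "e / 2"] e by auto
    have "norm (s n - l) < e" if "n \<ge> N" for n
    proof -
      have "s n - l = (s n - sum (f m) {..<n}) + (sum (f m) {..<n} - x m) + (x m - l)" by simp
      also have "norm \<dots> \<le> norm (s n - sum (f m) {..<n}) + norm (sum (f m) {..<n} - x m) + norm (x m - l)"
        by (intro order_trans[OF norm_triangle_ineq] add_right_mono norm_triangle_ineq)
      finally show ?thesis
        using near[of n m] N[OF that] small by (simp add: norm_minus_commute algebra_simps)
    qed
    then show "\<exists>N. \<forall>n\<ge>N. norm (s n - l) < e" by blast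
  qed
  then have "g sums l" by (simp add: sums_def sum_g)
  with gG show "l \<in> {x. \<exists>f. (\<forall>k. f k \<in> G k) \<and> f sums x}" by blast
qed

section \<open>The dual system of a representing system\<close>

lemma dual_system_iff:
  "\<phi> \<in> dual_system scl X k \<longleftrightarrow>
    \<phi> \<in> dual scl \<and> (\<forall>j x. j \<noteq> k \<longrightarrow> x \<in> X j \<longrightarrow> blinfun_apply \<phi> x = 0)"
proof -
  \<comment> \<open>Linearity of \<open>\<phi>\<close> is part of each annihilator, so some index \<open>j \<noteq> k\<close> is needed to obtain it.\<close>
  have "\<phi> \<in> dual_system scl X k \<longleftrightarrow> (\<forall>j. j \<noteq> k \<longrightarrow> \<phi> \<in> annihilator scl (X j))"
    by (simp add: dual_system_def)
  moreover have "\<phi> \<in> annihilator scl (X (Suc k)) \<Longrightarrow> \<phi> \<in> dual scl"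
    by (simp add: annihilator_def)
  ultimately show ?thesis
    using n_not_Suc_n[of k] by (auto simp: annihilator_def)
qed

lemma dual_system_permute:
  fixes scl :: "'k::{real_normed_field,banach} \<Rightarrow> 'a::banach \<Rightarrow> 'a"
  assumes "bij \<sigma>"
  shows "dual_system scl (\<lambda>k. X (\<sigma> k)) k = dual_system scl X (\<sigma> k)"
proof -
  have "(\<forall>j. j \<noteq> k \<longrightarrow> P (\<sigma> j)) \<longleftrightarrow> (\<forall>j. j \<noteq> \<sigma> k \<longrightarrow> P j)" for P
    using assms by (metis bij_pointE)
  from this[of "\<lambda>j. \<forall>x. x \<in> X j \<longrightarrow> blinfun_apply \<phi> x = 0"
      for \<phi> :: "'a \<Rightarrow>\<^sub>L 'k"] show ?thesis
    by (intro set_eqI) (simp add: dual_system_iff)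
qed

lemma closed_subspace_dual_system: "closed_subspace dual_scale (dual_system scl X k)"
proof -
  interpret D: banach_space_over "dual_scale :: _ \<Rightarrow> ('b::banach \<Rightarrow>\<^sub>L 'a) \<Rightarrow> _"
    by (rule banach_space_over_dual)
  have "dual_system scl X k = dual scl \<inter> (\<Inter>j\<in>-{k}. \<Inter>x\<in>X j. {\<phi>. blinfun_apply \<phi> x = 0})"
    by (auto simp: dual_system_iff)
  also have "closed \<dots>"
    using closed_subspace_dual[of scl]
    by (intro closed_Int closed_INT ballI closed_Collect_eq continuous_intros)
      (auto simp: closed_subspace_def)
  finally show ?thesis
    using closed_subspace_dual[of scl]
    by (auto simp: closed_subspace_def D.subspace_def dual_system_iff blinfun.bilinear_simps)
qed

lemma dual_system_sums_apply:
  assumes "\<And>k. f k \<in> dual_system scl X k" "f sums \<phi>" "x \<in> X k"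
  shows "blinfun_apply (f k) x = blinfun_apply \<phi> x"
proof -
  have "(\<lambda>j. blinfun_apply (f j) x) sums blinfun_apply \<phi> x"
    using assms(2) by (rule blinfun.bounded_linear_left[THEN bounded_linear.sums])
  moreover have "blinfun_apply (f j) x = 0" if "j \<noteq> k" for j
    using assms(1)[of j] assms(3) that by (auto simp: dual_system_iff)
  then have "(\<lambda>j. blinfun_apply (f j) x) sums blinfun_apply (f k) x"
    using sums_finite[of "{k}" "\<lambda>j. blinfun_apply (f j) x"] by simp
  ultimately show ?thesis
    by (rule sums_unique2[symmetric])
qed

lemma dual_system_eqI:
  fixes scl :: "'k::{real_normed_field,banach} \<Rightarrow> 'a::banach \<Rightarrow> 'a"
  assumes rep: "representing_system scl X"
    and mem: "\<phi> \<in> dual_system scl X k" "\<psi> \<in> dual_system scl X k"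
    and agree: "\<And>x. x \<in> X k \<Longrightarrow> blinfun_apply \<phi> x = blinfun_apply \<psi> x"
  shows "\<phi> = \<psi>"
proof (rule blinfun_eqI)
  fix x
  obtain xs where xs: "\<And>j. xs j \<in> X j" "xs sums x"
    using rep unfolding representing_system_def by metis
  have eq: "blinfun_apply \<phi> (xs j) = blinfun_apply \<psi> (xs j)" for j
    using mem agree xs(1)[of j] by (cases "j = k") (auto simp: dual_system_iff)
  have expand: "(\<lambda>j. blinfun_apply h (xs j)) sums blinfun_apply h x" for h :: "'a \<Rightarrow>\<^sub>L 'k"
    using xs(2) by (rule blinfun.bounded_linear_right[THEN bounded_linear.sums])
  show "blinfun_apply \<phi> x = blinfun_apply \<psi> x"
    using expand[of \<phi>] expand[of \<psi>] unfolding eq by (rule sums_unique2)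
qed

lemma dual_system_partial_sum_apply:
  assumes f: "\<And>k. f k \<in> dual_system scl X k"
    and xs: "\<And>k. xs k \<in> X k" "xs sums x" and "n \<le> N"
  shows "blinfun_apply (sum f {..<n}) x = blinfun_apply (sum f {..<N}) (sum xs {..<n})"
proof -
  have off: "blinfun_apply (f k) (xs j) = 0" if "j \<noteq> k" for j k
    using f[of k] xs(1)[of j] that by (auto simp: dual_system_iff)
  have fx: "blinfun_apply (f k) x = blinfun_apply (f k) (xs k)" for k
  proof -
    have "(\<lambda>j. blinfun_apply (f k) (xs j)) sums blinfun_apply (f k) x"
      using xs(2) by (rule blinfun.bounded_linear_right[THEN bounded_linear.sums])
    moreover have "(\<lambda>j. blinfun_apply (f k) (xs j)) sums blinfun_apply (f k) (xs k)"
      using sums_finite[of "{k}" "\<lambda>j. blinfun_apply (f k) (xs j)"] off by simp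
    ultimately show ?thesis by (rule sums_unique2)
  qed
  have "blinfun_apply (sum f {..<N}) (sum xs {..<n}) =
      (\<Sum>j<n. \<Sum>k<N. blinfun_apply (f k) (xs j))"
    by (simp add: blinfun.sum_left blinfun.sum_right)
  also have "\<dots> = (\<Sum>j<n. blinfun_apply (f j) (xs j))"
  proof (rule sum.cong)
    fix j assume "j \<in> {..<n}"
    then have "(\<Sum>k<N. blinfun_apply (f k) (xs j)) = (\<Sum>k\<in>{j}. blinfun_apply (f k) (xs j))"
      using off \<open>n \<le> N\<close> by (intro sum.mono_neutral_right) auto
    then show "(\<Sum>k<N. blinfun_apply (f k) (xs j)) = blinfun_apply (f j) (xs j)" by simp
  qed simp
  also have "\<dots> = blinfun_apply (sum f {..<n}) x"
    by (simp add: blinfun.sum_left fx)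
  finally show ?thesis by simp
qed

lemma dual_system_partial_sum_bound:
  fixes scl :: "'k::{real_normed_field,banach} \<Rightarrow> 'a::banach \<Rightarrow> 'a"
  assumes rep: "representing_system scl X"
  obtains C where "\<And>f n N. (\<And>k. f k \<in> dual_system scl X k) \<Longrightarrow> n \<le> N \<Longrightarrow>
    norm (sum f {..<n}) \<le> C * norm (sum f {..<N})"
proof -
  \<comment> \<open>If the full sum is zero, the inverse of its norm is \<open>0\<close> by convention and the element of
    \<open>F\<close> is \<open>0\<close>; the bound is then obtained separately.\<close>
  define F where "F = {inverse (norm (sum f {..<N})) *\<^sub>R sum f {..<n} | f n N.
    (\<forall>k. f k \<in> dual_system scl X k) \<and> n \<le> N}"
  have "bounded ((\<lambda>\<phi>. blinfun_apply \<phi> x) ` F)" for x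
  proof -
    obtain xs where xs: "\<And>j. xs j \<in> X j" "xs sums x"
      using rep unfolding representing_system_def by metis
    have "convergent (\<lambda>n. sum xs {..<n})"
      using xs(2) by (auto simp: sums_def convergent_def)
    then have "Bseq (\<lambda>n. sum xs {..<n})"
      by (rule convergent_imp_Bseq)
    then obtain B where B: "\<And>n. norm (sum xs {..<n}) \<le> B"
      by (auto simp: Bseq_def)
    have "norm (blinfun_apply \<phi> x) \<le> B" if "\<phi> \<in> F" for \<phi>
    proof -
      obtain f n N where f: "\<And>k. f k \<in> dual_system scl X k" and "n \<le> N"
        and \<phi>: "\<phi> = inverse (norm (sum f {..<N})) *\<^sub>R sum f {..<n}"
        using \<open>\<phi> \<in> F\<close> unfolding F_def by blast
      define \<psi> where "\<psi> = sum f {..<N}"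
      have "norm (blinfun_apply \<phi> x) = inverse (norm \<psi>) * norm (blinfun_apply \<psi> (sum xs {..<n}))"
        using dual_system_partial_sum_apply[OF f xs \<open>n \<le> N\<close>]
        by (simp add: \<phi> \<psi>_def blinfun.scaleR_left)
      also have "\<dots> \<le> inverse (norm \<psi>) * (norm \<psi> * B)"
        by (intro mult_left_mono order_trans[OF norm_blinfun] B) auto
      also have "\<dots> \<le> B"
        using order_trans[OF norm_ge_zero B[of 0]] by (cases "\<psi> = 0") (auto simp: field_simps)
      finally show ?thesis .
    qed
    then show ?thesis
      by (auto simp: bounded_iff)
  qed
  then obtain C where C: "\<And>\<phi>. \<phi> \<in> F \<Longrightarrow> norm \<phi> \<le> C"
    using uniform_boundedness[of F] by (auto simp: bounded_iff)
  show thesis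
  proof (rule that)
    fix f and n N :: nat
    assume f: "\<And>k. f k \<in> dual_system scl X k" and "n \<le> N"
    show "norm (sum f {..<n}) \<le> C * norm (sum f {..<N})"
    proof (cases "sum f {..<N} = 0")
      case True
      have "sum f {..<n} = 0"
      proof (rule blinfun_eqI)
        fix x
        obtain xs where "\<And>j. xs j \<in> X j" "xs sums x"
          using rep unfolding representing_system_def by metis
        from dual_system_partial_sum_apply[OF f this \<open>n \<le> N\<close>] True
        show "blinfun_apply (sum f {..<n}) x = blinfun_apply 0 x" by simp
      qed
      then show ?thesis using True by simp
    next
      case False
      have "inverse (norm (sum f {..<N})) *\<^sub>R sum f {..<n} \<in> F"
        using f \<open>n \<le> N\<close> by (auto simp: F_def)
      from C[OF this] False show ?thesis
        by (simp add: field_simps)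
    qed
  qed
qed

lemma closed_subspace_dual_system_sums:
  assumes rep: "representing_system scl X"
  shows "closed_subspace dual_scale
    {\<phi>. \<exists>f. (\<forall>k. f k \<in> dual_system scl X k) \<and> f sums \<phi>}" (is "closed_subspace _ ?T")
proof -
  interpret D: banach_space_over "dual_scale :: _ \<Rightarrow> ('b::banach \<Rightarrow>\<^sub>L 'a) \<Rightarrow> _"
    by (rule banach_space_over_dual)
  let ?G = "dual_system scl X"
  have sub: "D.subspace (?G k)" and cl: "closed (?G k)" for k
    using closed_subspace_dual_system[of scl X k] by (auto simp: closed_subspace_def)
  obtain C where "\<And>f n N. (\<And>k. f k \<in> ?G k) \<Longrightarrow> n \<le> N \<Longrightarrow>
      norm (sum f {..<n}) \<le> C * norm (sum f {..<N})"
    using dual_system_partial_sum_bound[OF rep] by blast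
  then have "closed ?T"
    by (intro closed_sums_of_subspaces cl D.subspace_diff[OF sub]) auto
  moreover have scale_sums: "(\<lambda>k. dual_scale c (f k)) sums dual_scale c \<phi>" if "f sums \<phi>"
    for c :: 'a and f and \<phi> :: "'b \<Rightarrow>\<^sub>L 'a"
    using bounded_bilinear.bounded_linear_right[OF bounded_bilinear_blinfun_compose] that
    unfolding dual_scale_def by (rule bounded_linear.sums)
  have "D.subspace ?T"
    unfolding D.subspace_def
  proof (intro conjI allI ballI)
    show "0 \<in> ?T"
      using D.subspace_0[OF sub] by (intro CollectI exI[of _ "\<lambda>_. 0"]) simp
    show "\<phi> + \<psi> \<in> ?T" if mem: "\<phi> \<in> ?T" "\<psi> \<in> ?T" for \<phi> \<psi>
    proof -
      obtain f g where "\<forall>k. f k \<in> ?G k" "f sums \<phi>" "\<forall>k. g k \<in> ?G k" "g sums \<psi>"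
        using mem by blast
      then show ?thesis
        using D.subspace_add[OF sub] sums_add[of f \<phi> g \<psi>]
        by (intro CollectI exI[of _ "\<lambda>k. f k + g k"]) simp
    qed
    show "dual_scale c \<phi> \<in> ?T" if mem: "\<phi> \<in> ?T" for c \<phi>
    proof -
      obtain f where "\<forall>k. f k \<in> ?G k" "f sums \<phi>"
        using mem by blast
      then show ?thesis
        using D.subspace_scale[OF sub] scale_sums[of f \<phi> c]
        by (intro CollectI exI[of _ "\<lambda>k. dual_scale c (f k)"]) simp
    qed
  qed
  ultimately show ?thesis
    by (simp add: closed_subspace_def)
qed

lemma closure_span_dual_system_eq:
  assumes rep: "representing_system scl X"
  shows "closure (module.span dual_scale (\<Union>k. dual_system scl X k)) =
    {\<phi>. \<exists>f. (\<forall>k. f k \<in> dual_system scl X k) \<and> f sums \<phi>}" (is "closure ?Y = ?T")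
proof -
  interpret D: banach_space_over "dual_scale :: _ \<Rightarrow> ('b::banach \<Rightarrow>\<^sub>L 'a) \<Rightarrow> _"
    by (rule banach_space_over_dual)
  let ?G = "dual_system scl X"
  have "closed ?T" "D.subspace ?T"
    using closed_subspace_dual_system_sums[OF rep] by (simp_all add: closed_subspace_def)
  moreover have "?G k \<subseteq> ?T" for k
  proof
    fix \<phi> assume "\<phi> \<in> ?G k"
    moreover have "0 \<in> ?G j" for j
      using closed_subspace_dual_system[of scl X j] D.subspace_0 by (simp add: closed_subspace_def)
    ultimately have "\<forall>j. (if j = k then \<phi> else 0) \<in> ?G j"
      by simp
    moreover have "(\<lambda>j. if j = k then \<phi> else 0) sums \<phi>"
      using sums_single[of k "\<lambda>_. \<phi>"] by simp
    ultimately show "\<phi> \<in> ?T"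
      by (intro CollectI exI[of _ "\<lambda>j. if j = k then \<phi> else 0"] conjI)
  qed
  ultimately have "closure ?Y \<subseteq> ?T"
    by (intro closure_minimal D.span_minimal UN_least)
  moreover have "?T \<subseteq> closure ?Y"
  proof
    fix \<phi> assume "\<phi> \<in> ?T"
    then obtain f where f: "\<And>k. f k \<in> ?G k" "f sums \<phi>" by blast
    then have "sum f {..<n} \<in> ?Y" for n
      by (intro D.span_sum D.span_base) auto
    with f(2) show "\<phi> \<in> closure ?Y"
      unfolding closure_sequential sums_def by (intro exI[of _ "\<lambda>n. sum f {..<n}"]) simp
  qed
  ultimately show ?thesis by blast
qed

section \<open>Rearrangements of the dual system\<close>

theorem mainTheorem3:
  fixes scl :: "'k::{real_normed_field,banach} \<Rightarrow> 'a::banach \<Rightarrow> 'a"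
    and X :: "nat \<Rightarrow> 'a set"
  assumes "banach_space_over scl"
    and "permutational_representing_system scl X"
  shows "unconditional_schauder_decomposition dual_scale
    (closure (module.span dual_scale (\<Union>k. dual_system scl X k)))
    (dual_system scl X)"
proof -
  interpret D: banach_space_over "dual_scale :: 'k \<Rightarrow> ('a \<Rightarrow>\<^sub>L 'k) \<Rightarrow> _"
    by (rule banach_space_over_dual)
  let ?G = "dual_system scl X"
  let ?T = "{\<phi>. \<exists>f. (\<forall>k. f k \<in> ?G k) \<and> f sums \<phi>}"
  have rep_perm: "representing_system scl (\<lambda>k. X (\<sigma> k))" if "bij \<sigma>" for \<sigma>
    using assms(2) that by (simp add: permutational_representing_system_def)
  have rep: "representing_system scl X"
    using rep_perm[of id] by simp
  define E where "E = closure (D.span (\<Union>k. ?G k))"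
  have E_eq: "E = ?T"
    unfolding E_def by (rule closure_span_dual_system_eq[OF rep])
  have E_perm: "E = {\<phi>. \<exists>f. (\<forall>k. f k \<in> ?G (\<sigma> k)) \<and> f sums \<phi>}" if "bij \<sigma>" for \<sigma>
  proof -
    have "(\<Union>k. ?G (\<sigma> k)) = (\<Union>k\<in>range \<sigma>. ?G k)"
      by blast
    also have "range \<sigma> = UNIV"
      using that by (rule bij_is_surj)
    finally have "(\<Union>k. ?G (\<sigma> k)) = (\<Union>k. ?G k)" .
    then show ?thesis
      using closure_span_dual_system_eq[OF rep_perm[OF that]]
      by (simp add: dual_system_permute[OF that] E_def)
  qed
  have "closed_subspace dual_scale E"
    unfolding E_eq by (rule closed_subspace_dual_system_sums[OF rep])
  moreover have "?G k \<subseteq> E" for k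
    unfolding E_def
    by (intro order_trans[OF _ closure_subset] order_trans[OF _ D.span_superset]) blast
  moreover have "\<exists>!f. (\<forall>k. f k \<in> ?G k) \<and> f sums \<phi>" if "\<phi> \<in> E" for \<phi>
  proof (rule ex_ex1I)
    show "\<exists>f. (\<forall>k. f k \<in> ?G k) \<and> f sums \<phi>"
      using that unfolding E_eq by blast
    show "f = g" if "(\<forall>k. f k \<in> ?G k) \<and> f sums \<phi>" "(\<forall>k. g k \<in> ?G k) \<and> g sums \<phi>" for f g
    proof
      fix k
      have f: "\<And>k. f k \<in> ?G k" "f sums \<phi>" and g: "\<And>k. g k \<in> ?G k" "g sums \<phi>"
        using that by auto
      show "f k = g k"
        using rep f(1) g(1)
      proof (rule dual_system_eqI)
        show "blinfun_apply (f k) x = blinfun_apply (g k) x" if "x \<in> X k" for x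
          using dual_system_sums_apply[OF f that] dual_system_sums_apply[OF g that] by simp
      qed
    qed
  qed
  ultimately have "schauder_decomposition dual_scale E ?G"
    by (simp add: schauder_decomposition_def closed_subspace_dual_system)
  moreover have "unconditionally_convergent f" if f: "\<forall>k. f k \<in> ?G k" "summable f" for f
    unfolding unconditionally_convergent_def
  proof (intro allI impI)
    fix \<sigma> :: "nat \<Rightarrow> nat" assume \<sigma>: "bij \<sigma>"
    have f_sums: "f sums suminf f"
      using f(2) by (rule summable_sums)
    with f(1) have "suminf f \<in> E" unfolding E_eq by blast
    then obtain g where g: "\<And>k. g k \<in> ?G (\<sigma> k)" "g sums suminf f"
      unfolding E_perm[OF \<sigma>] by blast
    \<comment> \<open>Both sides agree with \<open>suminf f\<close> on \<open>X (\<sigma> k)\<close>.\<close>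
    have "g k = f (\<sigma> k)" for k
    proof (rule dual_system_eqI[OF rep])
      show "g k \<in> ?G (\<sigma> k)" "f (\<sigma> k) \<in> ?G (\<sigma> k)"
        using f(1) g(1) by auto
      show "blinfun_apply (g k) x = blinfun_apply (f (\<sigma> k)) x" if "x \<in> X (\<sigma> k)" for x
        using dual_system_sums_apply[of g scl "\<lambda>k. X (\<sigma> k)" "suminf f" x k]
          dual_system_sums_apply[of f scl X "suminf f" x "\<sigma> k"] f(1) f_sums g that
        by (simp add: dual_system_permute[OF \<sigma>])
    qed
    then have "g = (\<lambda>k. f (\<sigma> k))" by blast
    with g(2) show "summable (\<lambda>k. f (\<sigma> k))"
      by (auto simp: sums_iff)
  qed
  ultimately show ?thesis
    unfolding unconditional_schauder_decomposition_def E_def by blast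
qed

end
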